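(* Let $d\in\mathbb{N}$, $A\in M_d$, $\theta\in\mathbb{R}$ and let $x\in\mathbb{C}^d$ be a unit vector. Then $f_A(x)=p_+(\theta)$ if and only if $x\in X_+(\theta)$, and $f_A(x)=p_-(\theta)$ if and only if $x\in X_-(\theta)$.
   Context: $M_d$ is the set of complex $d\times d$ matrices. On $\mathbb{C}\cong\mathbb{R}^2$ use the scalar product $\langle\alpha,\beta\rangle=\Re(\alpha\overline{\beta})$. For $A\in M_d$, $f_A(x)=x^*Ax$ for unit vectors $x\in\mathbb{C}^d$, and $W(A)=\{f_A(x)\mid x\in\mathbb{C}^d,\ x^*x=1\}$ is the numerical range. For $B\in M_d$ and a subspace $X\subset\mathbb{C}^d$ with orthogonal projection $P$ onto $X$, the compression $B|_X$ is the restriction of $PBP$ to $X$. Put $\Re(B)=\tfrac12(B+B^* )$, $\Im(B)=\tfrac1{2\mathrm{i}}(B-B^* )$. For $\theta\in\mathbb{R}$: $A(\theta)=\Re(e^{-\mathrm{i}\theta}A)$; $A'(\theta)=\Im(e^{-\mathrm{i}\theta}A)$ is its derivative with respect to $\theta$; $\lambda_{\mathrm m}(\theta)$ is the maximal eigenvalue of $A(\theta)$; $X_{\mathrm m}(\theta)$ is the corresponding eigenspace of $A(\theta)$; $\lambda_{\mathrm m}'(\theta;v)=\lim_{t\to0^+}\tfrac1t(\lambda_{\mathrm m}(\theta+tv)-\lambda_{\mathrm m}(\theta))$ for $v=\pm1$ (the limit exists). $F_A(\theta)=\operatorname{argmax}_{\alpha\in W(A)}\langle\alpha,e^{\mathrm{i}\theta}\rangle$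 is the exposed face of $W(A)$ with outward normal vector $e^{\mathrm{i}\theta}$, a segment or a point; its endpoints $p_+(\theta),p_-(\theta)$ (not necessarily distinct) are the points of $F_A(\theta)$ characterized by $\langle p_\pm(\theta),\pm\mathrm{i}e^{\mathrm{i}\theta}\rangle=\max_{\alpha\in F_A(\theta)}\langle\alpha,\pm\mathrm{i}e^{\mathrm{i}\theta}\rangle$. The numbers $\lambda_{\mathrm m}'(\theta;1)$ and $-\lambda_{\mathrm m}'(\theta;-1)$ are, respectively, the maximal and the minimal eigenvalue of the compression $A'(\theta)|_{X_{\mathrm m}(\theta)}$; $X_+(\theta)$ and $X_-(\theta)$ denote, respectively, the eigenspaces of $A'(\theta)|_{X_{\mathrm m}(\theta)}$ (subspaces of $X_{\mathrm m}(\theta)$) corresponding to the eigenvalues $\lambda_{\mathrm m}'(\theta;1)$ and $-\lambda_{\mathrm m}'(\theta;-1)$. *)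

theory Defs
  imports "HOL-Analysis.Analysis"
begin

text \<open>
  \<open>M\<^sub>d\<close> is the type \<^typ>\<open>complex^'n^'n\<close> with \<open>d = CARD('n)\<close>. The scalar product
  \<open>\<langle>\<alpha>,\<beta>\<rangle> = \<Re>(\<alpha> \<beta>\<^sup>*)\<close> on the complex plane is the library's \<open>\<alpha> \<bullet> \<beta>\<close>.
\<close>

text \<open>\<open>x\<^sup>* y\<close>, conjugate-linear in the first argument.\<close>
definition cinner :: "complex^'n \<Rightarrow> complex^'n \<Rightarrow> complex" where
  "cinner x y = (\<Sum>i\<in>UNIV. cnj (x $ i) * y $ i)"

lemma cinner_self: "cinner x x = complex_of_real ((norm x)\<^sup>2)"
proof -
  have "cnj (x $ i) * x $ i = complex_of_real ((norm (x $ i))\<^sup>2)" for i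
    by (metis complex_norm_square mult.commute of_real_power)
  then show ?thesis
    by (simp add: cinner_def norm_vec_def L2_set_def sum_nonneg)
qed

lemma cinner_self_eq_1_iff: "cinner x x = 1 \<longleftrightarrow> norm x = 1"
  unfolding cinner_self of_real_eq_1_iff
  by (simp add: power2_eq_1_iff) (smt (verit) norm_ge_zero)

definition mat_scale :: "complex \<Rightarrow> complex^'n^'n \<Rightarrow> complex^'n^'n" where
  "mat_scale c B = (\<chi> i j. c * B $ i $ j)"

definition conj_transpose :: "complex^'n^'n \<Rightarrow> complex^'n^'n" where
  "conj_transpose B = (\<chi> i j. cnj (B $ j $ i))"

definition mat_Re :: "complex^'n^'n \<Rightarrow> complex^'n^'n" where
  "mat_Re B = mat_scale (1 / 2) (B + conj_transpose B)"

definition mat_Im :: "complex^'n^'n \<Rightarrow> complex^'n^'n" where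
  "mat_Im B = mat_scale (1 / (2 * \<i>)) (B - conj_transpose B)"

definition num_form :: "complex^'n^'n \<Rightarrow> complex^'n \<Rightarrow> complex" where
  "num_form A x = cinner x (A *v x)"

definition numerical_range :: "complex^'n^'n \<Rightarrow> complex set" where
  "numerical_range A = {num_form A x | x. cinner x x = 1}"

text \<open>
  Eigenspaces of a map \<open>T : X \<rightarrow> X\<close> on a complex subspace \<open>X\<close>; for a matrix \<open>B\<close> take
  \<open>X = UNIV\<close> and \<open>T = (*v) B\<close>.
\<close>
definition eigenspace_on ::
    "(complex^'n) set \<Rightarrow> (complex^'n \<Rightarrow> complex^'n) \<Rightarrow> complex \<Rightarrow> (complex^'n) set" where
  "eigenspace_on X T c = {v \<in> X. T v = c *s v}"

definition eigenvalue_on ::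
    "(complex^'n) set \<Rightarrow> (complex^'n \<Rightarrow> complex^'n) \<Rightarrow> complex \<Rightarrow> bool" where
  "eigenvalue_on X T c \<longleftrightarrow> (\<exists>v \<in> eigenspace_on X T c. v \<noteq> 0)"

definition orth_proj :: "(complex^'n) set \<Rightarrow> complex^'n \<Rightarrow> complex^'n" where
  "orth_proj X x = (THE y. y \<in> X \<and> (\<forall>z\<in>X. cinner z (x - y) = 0))"

definition compression :: "complex^'n^'n \<Rightarrow> (complex^'n) set \<Rightarrow> complex^'n \<Rightarrow> complex^'n" where
  "compression B X = restrict (\<lambda>x. orth_proj X (B *v orth_proj X x)) X"

definition A_rot :: "complex^'n^'n \<Rightarrow> real \<Rightarrow> complex^'n^'n" where
  "A_rot A \<theta> = mat_Re (mat_scale (exp (- \<i> * \<theta>)) A)"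

definition A_rot' :: "complex^'n^'n \<Rightarrow> real \<Rightarrow> complex^'n^'n" where
  "A_rot' A \<theta> = mat_Im (mat_scale (exp (- \<i> * \<theta>)) A)"

text \<open>
  The eigenvalues of the Hermitian matrix \<open>A(\<theta>)\<close> are real, so the maximum is taken over real
  numbers.
\<close>
definition lambda_m :: "complex^'n^'n \<Rightarrow> real \<Rightarrow> real" where
  "lambda_m A \<theta> = (GREATEST r::real. eigenvalue_on UNIV ((*v) (A_rot A \<theta>)) (of_real r))"

definition X_m :: "complex^'n^'n \<Rightarrow> real \<Rightarrow> (complex^'n) set" where
  "X_m A \<theta> = eigenspace_on UNIV ((*v) (A_rot A \<theta>)) (of_real (lambda_m A \<theta>))"

text \<open>The one-sided derivative \<open>\<lambda>\<^sub>m'(\<theta>; v)\<close>, used for \<open>v = 1\<close> and \<open>v = -1\<close>.\<close>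
definition lambda_m' :: "complex^'n^'n \<Rightarrow> real \<Rightarrow> real \<Rightarrow> real" where
  "lambda_m' A \<theta> v = Lim (at_right 0) (\<lambda>t. (1 / t) * (lambda_m A (\<theta> + t * v) - lambda_m A \<theta>))"

definition X_plus :: "complex^'n^'n \<Rightarrow> real \<Rightarrow> (complex^'n) set" where
  "X_plus A \<theta> =
    eigenspace_on (X_m A \<theta>) (compression (A_rot' A \<theta>) (X_m A \<theta>)) (of_real (lambda_m' A \<theta> 1))"

definition X_minus :: "complex^'n^'n \<Rightarrow> real \<Rightarrow> (complex^'n) set" where
  "X_minus A \<theta> =
    eigenspace_on (X_m A \<theta>) (compression (A_rot' A \<theta>) (X_m A \<theta>)) (of_real (- lambda_m' A \<theta> (-1)))"

definition exp_face :: "complex^'n^'n \<Rightarrow> real \<Rightarrow> complex set" where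
  "exp_face A \<theta> =
    {\<alpha>. is_arg_max (\<lambda>\<beta>. \<beta> \<bullet> exp (\<i> * \<theta>)) (\<lambda>\<beta>. \<beta> \<in> numerical_range A) \<alpha>}"

definition p_plus :: "complex^'n^'n \<Rightarrow> real \<Rightarrow> complex" where
  "p_plus A \<theta> =
    (THE p. is_arg_max (\<lambda>\<alpha>. \<alpha> \<bullet> (\<i> * exp (\<i> * \<theta>))) (\<lambda>\<alpha>. \<alpha> \<in> exp_face A \<theta>) p)"

definition p_minus :: "complex^'n^'n \<Rightarrow> real \<Rightarrow> complex" where
  "p_minus A \<theta> =
    (THE p. is_arg_max (\<lambda>\<alpha>. \<alpha> \<bullet> (- \<i> * exp (\<i> * \<theta>))) (\<lambda>\<alpha>. \<alpha> \<in> exp_face A \<theta>) p)"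

end

theory Submission
  imports Defs
begin

text \<open>
  Write \<open>f = f\<^sub>A\<close>, \<open>u = exp(\<i>\<theta>)\<close>, and let \<open>v\<close> be \<open>1\<close> or \<open>-1\<close>. On a unit vector \<open>x\<close> the quadratic forms
  of \<open>A(\<theta>)\<close> and \<open>A'(\<theta>)\<close> are the two coordinates \<open>\<langle>f x, u\<rangle>\<close> and \<open>\<langle>f x, \<i>u\<rangle>\<close> of the point
  \<open>f x\<close>. Now \<open>p\<^sub>\<plusminus>(\<theta>)\<close> is the result of maximizing the first coordinate over the numerical
  range and then \<open>\<plusminus>\<close> the second coordinate over the resulting face. On the other side, the unit
  vectors of \<open>X\<^sub>\<plusminus>(\<theta>)\<close> turn out to be those that maximize the first form over all unit vectors
  and then \<open>\<plusminus>\<close> the second form among these maximizers. So both sides of the equivalence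
  describe the same two-step maximization.

  Two facts turn eigenspaces into sets of maximizers. First, for a Hermitian form that is bounded
  by \<open>\<mu>\<close> on the unit vectors of a subspace, a unit vector of the subspace attains \<open>\<mu>\<close> if and only
  if it is an eigenvector of the compression for \<open>\<mu>\<close> (\<open>maximizer_stationary\<close>,
  \<open>compression_eigenspace_iff\<close>). Second, the
  one-sided derivative of \<open>\<lambda>\<^sub>m\<close> really is the maximum found in the second step: along the rotation,
  \<open>\<lambda>\<^sub>m(\<theta> + tv)\<close> is the maximum of \<open>cos t \<langle>f x, u\<rangle> + sin t \<langle>f x, v\<i>u\<rangle>\<close>, and the right derivative
  at \<open>0\<close> of such a maximum is the largest derivative among the maximizers at \<open>t = 0\<close>
  (\<open>rotated_max_right_derivative\<close>, a case of Danskin's theorem). The argument is the same for both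
  signs and is carried out once, with \<open>v\<close> as a parameter.
\<close>

section \<open>The Hermitian inner product\<close>

lemma cinner_add_left: "cinner (x + y) z = cinner x z + cinner y z"
  by (simp add: cinner_def algebra_simps sum.distrib)

lemma cinner_add_right: "cinner x (y + z) = cinner x y + cinner x z"
  by (simp add: cinner_def algebra_simps sum.distrib)

lemma cinner_diff_right: "cinner x (y - z) = cinner x y - cinner x z"
  by (simp add: cinner_def algebra_simps sum_subtractf)

lemma cinner_scale_left: "cinner (c *s x) y = cnj c * cinner x y"
  by (simp add: cinner_def sum_distrib_left mult.assoc)

lemma cinner_scale_right: "cinner x (c *s y) = c * cinner x y"
  by (simp add: cinner_def sum_distrib_left mult_ac)

lemma scaleR_eq_vector_scalar_mult: "r *\<^sub>R (x :: complex^'n) = of_real r *s x"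
  unfolding vec_eq_iff by (simp add: scaleR_conv_of_real[where 'a = complex])

lemma cnj_cinner: "cnj (cinner x y) = cinner y x"
  by (simp add: cinner_def mult.commute)

lemma inner_eq_Re_cinner: "x \<bullet> y = Re (cinner x y)"
  by (simp add: cinner_def inner_vec_def inner_complex_def)

lemma cinner_conj_transpose: "cinner x (conj_transpose B *v y) = cinner (B *v x) y"
  unfolding cinner_def conj_transpose_def matrix_vector_mult_def
  by (simp add: sum_distrib_left sum_distrib_right mult_ac)
     (subst sum.swap, simp add: mult_ac)

lemma mat_scale_mult_vec: "mat_scale c B *v x = c *s (B *v x)"
  by (simp add: mat_scale_def matrix_vector_mult_def vec_eq_iff sum_distrib_left mult.assoc)

definition hermitian :: "complex^'n^'n \<Rightarrow> bool" where
  "hermitian B \<longleftrightarrow> (\<forall>x y. cinner (B *v x) y = cinner x (B *v y))"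

lemma num_form_conj_transpose: "cinner x (conj_transpose B *v x) = cnj (num_form B x)"
  by (simp add: cinner_conj_transpose num_form_def cnj_cinner)

lemma cinner_mat_Re:
  "cinner x (mat_Re B *v y) = (cinner x (B *v y) + cinner (B *v x) y) / 2"
  by (simp add: mat_Re_def mat_scale_mult_vec cinner_scale_right
      matrix_vector_mult_add_rdistrib cinner_add_right cinner_conj_transpose)

lemma cinner_mat_Im:
  "cinner x (mat_Im B *v y) = (cinner x (B *v y) - cinner (B *v x) y) / (2 * \<i>)"
  by (simp add: mat_Im_def mat_scale_mult_vec cinner_scale_right
      matrix_vector_mult_diff_rdistrib cinner_diff_right cinner_conj_transpose)
     (simp add: algebra_simps diff_divide_distrib)

lemma hermitian_mat_Re: "hermitian (mat_Re B)"
  unfolding hermitian_def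
proof (intro allI)
  fix x y
  have "cinner (mat_Re B *v x) y = cnj (cinner y (mat_Re B *v x))"
    by (simp add: cnj_cinner)
  then show "cinner (mat_Re B *v x) y = cinner x (mat_Re B *v y)"
    by (simp add: cinner_mat_Re cnj_cinner add.commute)
qed

lemma hermitian_mat_Im: "hermitian (mat_Im B)"
  unfolding hermitian_def
proof (intro allI)
  fix x y
  have "cinner (mat_Im B *v x) y = cnj (cinner y (mat_Im B *v x))"
    by (simp add: cnj_cinner)
  then show "cinner (mat_Im B *v x) y = cinner x (mat_Im B *v y)"
    by (simp add: cinner_mat_Im cnj_cinner field_simps)
qed

lemma num_form_mat_Re: "num_form (mat_Re B) x = of_real (Re (num_form B x))"
  using num_form_conj_transpose[of x B]
  by (simp add: num_form_def cinner_mat_Re cinner_conj_transpose complex_add_cnj)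

lemma num_form_mat_Im: "num_form (mat_Im B) x = of_real (Im (num_form B x))"
  using num_form_conj_transpose[of x B]
  by (simp add: num_form_def cinner_mat_Im cinner_conj_transpose complex_diff_cnj)
     (simp add: complex_eq_iff)

lemma num_form_mat_scale: "num_form (mat_scale c B) x = c * num_form B x"
  by (simp add: num_form_def mat_scale_mult_vec cinner_scale_right)

lemma exp_minus_ii: "exp (- \<i> * of_real \<theta>) = cis (- \<theta>)"
  by (simp add: cis_conv_exp)

text \<open>
  Multiplication by \<open>exp(-\<i>\<theta>)\<close> rotates the frame \<open>exp(\<i>\<theta>)\<close>, \<open>\<i> exp(\<i>\<theta>)\<close> to \<open>1\<close>, \<open>\<i>\<close>, so the
  coordinates of \<open>x\<^sup>* A x\<close> in that frame are the real and the imaginary part of the rotated form.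
\<close>
lemma num_form_A_rot: "num_form (A_rot A \<theta>) x = of_real (num_form A x \<bullet> exp (\<i> * \<theta>))"
  unfolding A_rot_def num_form_mat_Re num_form_mat_scale exp_minus_ii cis_conv_exp[symmetric]
  by (simp add: inner_complex_def algebra_simps)

lemma num_form_A_rot':
  "num_form (A_rot' A \<theta>) x = of_real (num_form A x \<bullet> (\<i> * exp (\<i> * \<theta>)))"
  unfolding A_rot'_def num_form_mat_Im num_form_mat_scale exp_minus_ii cis_conv_exp[symmetric]
  by (simp add: inner_complex_def algebra_simps)

lemma num_form_scaleR: "num_form B (r *\<^sub>R x) = of_real (r\<^sup>2) * num_form B x"
  by (simp add: num_form_def scaleR_eq_vector_scalar_mult vector_scalar_commute
      cinner_scale_left cinner_scale_right power2_eq_square)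

lemma continuous_on_num_form: "continuous_on S (num_form B)"
  unfolding num_form_def cinner_def matrix_vector_mult_def
  by (simp, intro continuous_intros)

section \<open>Compressions and maximizers of Hermitian forms\<close>

definition csubspace :: "(complex^'n) set \<Rightarrow> bool" where
  "csubspace X \<longleftrightarrow> 0 \<in> X \<and> (\<forall>x\<in>X. \<forall>y\<in>X. x + y \<in> X) \<and> (\<forall>c. \<forall>x\<in>X. c *s x \<in> X)"

lemma csubspace_imp_subspace: "csubspace X \<Longrightarrow> subspace X"
  by (auto simp: csubspace_def subspace_def scaleR_eq_vector_scalar_mult)

lemma csubspace_UNIV: "csubspace UNIV"
  by (simp add: csubspace_def)

lemma csubspace_eigenspace: "csubspace (eigenspace_on UNIV ((*v) B) c)"
  by (simp add: csubspace_def eigenspace_on_def matrix_vector_right_distrib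
      vector_scalar_commute vector_add_ldistrib mult.commute)

lemma cinner_zero_if_Re_zero:
  assumes "csubspace X" and "\<And>z. z \<in> X \<Longrightarrow> Re (cinner z y) = 0" and "z \<in> X"
  shows "cinner z y = 0"
proof -
  have "\<i> *s z \<in> X"
    using assms(1,3) by (simp add: csubspace_def)
  then have "Re (cinner (\<i> *s z) y) = 0"
    by (rule assms(2))
  then show ?thesis
    using assms(2)[OF assms(3)] by (simp add: cinner_scale_left complex_eq_iff)
qed

text \<open>
  The real orthogonal decomposition suffices: on a complex subspace, vanishing of the real part
  of \<open>z\<^sup>* y\<close> for \<open>z\<close> and \<open>\<i>z\<close> gives vanishing of \<open>z\<^sup>* y\<close>.
\<close>
lemma orth_proj_eq_iff:
  assumes X: "csubspace X"
  shows "orth_proj X x = y \<longleftrightarrow> y \<in> X \<and> (\<forall>z\<in>X. cinner z (x - y) = 0)"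
proof -
  let ?P = "\<lambda>y. y \<in> X \<and> (\<forall>z\<in>X. cinner z (x - y) = 0)"
  have sub: "subspace X"
    using X by (rule csubspace_imp_subspace)
  have uniq: "y1 = y2" if "?P y1" "?P y2" for y1 y2
  proof -
    have "y1 - y2 \<in> X"
      using that sub by (simp add: subspace_diff)
    then have "cinner (y1 - y2) (x - y2) - cinner (y1 - y2) (x - y1) = 0"
      using that by simp
    then have "cinner (y1 - y2) (y1 - y2) = 0"
      by (simp flip: cinner_diff_right)
    then show "y1 = y2"
      by (simp add: cinner_self)
  qed
  obtain y0 w where y0: "y0 \<in> span X" "\<And>z. z \<in> span X \<Longrightarrow> orthogonal w z" "x = y0 + w"
    by (rule orthogonal_subspace_decomp_exists[of X x]) blast
  have P0: "?P y0"
  proof (intro conjI ballI)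
    show "y0 \<in> X"
      using y0(1) sub by (simp add: span_eq_iff[THEN iffD2])
    fix z assume "z \<in> X"
    show "cinner z (x - y0) = 0"
    proof (rule cinner_zero_if_Re_zero[OF X _ \<open>z \<in> X\<close>])
      fix z assume "z \<in> X"
      then have "z \<bullet> w = 0"
        using y0(2)[OF span_base] unfolding orthogonal_def by (subst inner_commute) simp
      then show "Re (cinner z (x - y0)) = 0"
        using y0(3) by (simp add: inner_eq_Re_cinner)
    qed
  qed
  have "?P (orth_proj X x)"
    unfolding orth_proj_def by (rule theI[where P = ?P, OF P0]) (rule uniq[OF _ P0])
  then show ?thesis
    using uniq by blast
qed

lemma num_form_le_normalized:
  assumes X: "csubspace X"
    and le: "\<And>y. y \<in> X \<Longrightarrow> norm y = 1 \<Longrightarrow> Re (num_form B y) \<le> \<mu>"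
    and y: "y \<in> X"
  shows "Re (num_form B y) \<le> \<mu> * (norm y)\<^sup>2"
proof (cases "y = 0")
  case True
  then show ?thesis
    by (simp add: num_form_def cinner_def)
next
  case False
  have "y /\<^sub>R norm y \<in> X"
    using csubspace_imp_subspace[OF X] y by (simp add: subspace_scale)
  then have "Re (num_form B (y /\<^sub>R norm y)) \<le> \<mu>"
    using False by (intro le) auto
  then show ?thesis
    using False by (simp add: num_form_scaleR power2_eq_square field_simps)
qed

text \<open>
  A quadratic polynomial in \<open>t\<close> without constant term can only be nonnegative on all of \<open>\<real>\<close> if its
  linear coefficient vanishes; here the polynomial is \<open>\<mu> \<parallel>y\<parallel>\<^sup>2 - y\<^sup>* B y\<close> along \<open>y = x + t z\<close>.
\<close>
lemma maximizer_stationary: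
  assumes X: "csubspace X" and B: "hermitian B"
    and le: "\<And>y. y \<in> X \<Longrightarrow> norm y = 1 \<Longrightarrow> Re (num_form B y) \<le> \<mu>"
    and x: "x \<in> X" "norm x = 1" "Re (num_form B x) = \<mu>"
    and z: "z \<in> X"
  shows "cinner z (B *v x - of_real \<mu> *s x) = 0"
proof (rule cinner_zero_if_Re_zero[OF X _ z])
  fix z assume z: "z \<in> X"
  define b where "b = Re (cinner z (B *v x - of_real \<mu> *s x))"
  define c where "c = \<mu> * (norm z)\<^sup>2 - Re (num_form B z)"
  have poly: "0 \<le> t\<^sup>2 * c - 2 * t * b" for t :: real
  proof -
    have mem: "x + t *\<^sub>R z \<in> X"
      using csubspace_imp_subspace[OF X] x z by (simp add: subspace_add subspace_scale)
    have "cinner x (B *v z) = cnj (cinner z (B *v x))"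
      using B by (simp add: hermitian_def cnj_cinner)
    then have form: "Re (num_form B (x + t *\<^sub>R z))
        = Re (num_form B x) + 2 * t * Re (cinner z (B *v x)) + t\<^sup>2 * Re (num_form B z)"
      by (simp add: num_form_def scaleR_eq_vector_scalar_mult matrix_vector_right_distrib
          vector_scalar_commute cinner_add_left cinner_add_right cinner_scale_left
          cinner_scale_right power2_eq_square algebra_simps)
    have nrm: "(norm (x + t *\<^sub>R z))\<^sup>2 = 1 + 2 * t * Re (cinner z x) + t\<^sup>2 * (norm z)\<^sup>2"
      unfolding power2_norm_eq_inner
      using x(2) by (simp add: inner_add_left inner_add_right inner_commute norm_eq_1
          power2_eq_square algebra_simps flip: inner_eq_Re_cinner)
    show ?thesis
      using num_form_le_normalized[OF X le mem] x(3)
      by (simp add: form nrm b_def c_def cinner_diff_right cinner_scale_right algebra_simps)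
  qed
  have "c \<ge> 0"
    using num_form_le_normalized[OF X le z] by (simp add: c_def)
  \<comment> \<open>The parabola takes the value \<open>- (b\<^sup>2 (c + 2) / (c + 1)\<^sup>2)\<close> at \<open>t = b / (c + 1)\<close>; adding
    \<open>1\<close> covers \<open>c = 0\<close>.\<close>
  have "0 \<le> (b / (c + 1))\<^sup>2 * c - 2 * (b / (c + 1)) * b"
    by (rule poly)
  also have "\<dots> = - (b\<^sup>2 * (c + 2) / (c + 1)\<^sup>2)"
    using \<open>c \<ge> 0\<close> by (simp add: power2_eq_square divide_simps) (simp add: algebra_simps)
  finally have "b\<^sup>2 * (c + 2) / (c + 1)\<^sup>2 \<le> 0"
    by simp
  then have "b\<^sup>2 \<le> 0"
    using \<open>c \<ge> 0\<close> by (simp add: divide_le_0_iff mult_le_0_iff power2_eq_square)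
  then show "Re (cinner z (B *v x - of_real \<mu> *s x)) = 0"
    by (simp add: b_def)
qed

text \<open>
  An eigenvector \<open>x\<close> of the compression satisfies \<open>B x - \<mu> x \<bottom> X\<close>, hence \<open>x\<^sup>* B x = \<mu>\<close>; conversely
  a maximizer is stationary, and \<open>B x - \<mu> x \<bottom> X\<close> says that \<open>\<mu> x\<close> is the projection of \<open>B x\<close>.
  The sign \<open>s\<close> lets one statement cover both ends of the spectrum: \<open>\<mu>\<close> bounds the form from
  above for \<open>s = 1\<close> and from below for \<open>s = -1\<close>.
\<close>
lemma compression_eigenspace_iff:
  assumes X: "csubspace X" and B: "hermitian B"
    and bound: "\<forall>y\<in>X. norm y = 1 \<longrightarrow> s * Re (num_form B y) \<le> s * \<mu>"
    and s: "s = 1 \<or> s = -1"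
    and x: "norm x = 1"
  shows "x \<in> eigenspace_on X (compression B X) (of_real \<mu>)
    \<longleftrightarrow> x \<in> X \<and> Re (num_form B x) = \<mu>"
proof -
  have "compression B X x = of_real \<mu> *s x \<longleftrightarrow> Re (num_form B x) = \<mu>" if "x \<in> X"
  proof -
    have "orth_proj X x = x"
      using that by (subst orth_proj_eq_iff[OF X]) (simp add: cinner_def)
    then have "compression B X x = orth_proj X (B *v x)"
      using that by (simp add: compression_def)
    moreover have "of_real \<mu> *s x \<in> X"
      using X that by (simp add: csubspace_def)
    ultimately have "compression B X x = of_real \<mu> *s x
        \<longleftrightarrow> (\<forall>z\<in>X. cinner z (B *v x - of_real \<mu> *s x) = 0)"
      by (simp add: orth_proj_eq_iff[OF X])
    also have "\<dots> \<longleftrightarrow> Re (num_form B x) = \<mu>"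
    proof
      assume "\<forall>z\<in>X. cinner z (B *v x - of_real \<mu> *s x) = 0"
      then have "cinner x (B *v x - of_real \<mu> *s x) = 0"
        using that by blast
      then show "Re (num_form B x) = \<mu>"
        using x by (simp add: cinner_diff_right cinner_scale_right num_form_def cinner_self)
    next
      assume eq: "Re (num_form B x) = \<mu>"
      \<comment> \<open>For \<open>s = -1\<close> the vector \<open>x\<close> minimizes the form of \<open>B\<close>, so it maximizes that of \<open>-B\<close>.\<close>
      let ?C = "mat_scale (of_real s) B"
      have "hermitian ?C"
        using B by (simp add: hermitian_def mat_scale_mult_vec cinner_scale_left cinner_scale_right)
      then have "cinner z (?C *v x - of_real (s * \<mu>) *s x) = 0" if "z \<in> X" for z
        using maximizer_stationary[OF X, of ?C "s * \<mu>" x z] bound that \<open>x \<in> X\<close> x eq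
        by (simp add: num_form_mat_scale)
      moreover have "?C *v x - of_real (s * \<mu>) *s x = of_real s *s (B *v x - of_real \<mu> *s x)"
        by (simp add: mat_scale_mult_vec vec_eq_iff algebra_simps)
      ultimately have "of_real s * cinner z (B *v x - of_real \<mu> *s x) = 0" if "z \<in> X" for z
        using that by (simp only: cinner_scale_right)
      then show "\<forall>z\<in>X. cinner z (B *v x - of_real \<mu> *s x) = 0"
        using s by (metis mult_eq_0_iff of_real_eq_0_iff zero_neq_neg_one zero_neq_one)
    qed
    finally show ?thesis .
  qed
  then show ?thesis
    by (auto simp: eigenspace_on_def)
qed

section \<open>The largest eigenvalue as a maximum over unit vectors\<close>

lemma unit_sphere_attains_max:
  fixes \<phi> :: "complex^'n \<Rightarrow> real"
  assumes "continuous_on (sphere 0 1) \<phi>"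
  obtains x where "norm x = 1" "\<And>y. norm y = 1 \<Longrightarrow> \<phi> y \<le> \<phi> x"
proof -
  obtain e :: "complex^'n" where "norm e = 1"
    using vector_choose_size[of 1] by auto
  then have "sphere 0 1 \<noteq> ({} :: (complex^'n) set)"
    by auto
  then show thesis
    using continuous_attains_sup[OF compact_sphere _ assms] that by auto
qed

text \<open>
  The form of \<open>A(\<theta>)\<close> attains its maximum over the unit sphere by compactness; a maximizer is
  stationary, hence an eigenvector, and the form at any unit eigenvector is the eigenvalue.
\<close>
lemma lambda_m_max:
  obtains x where "norm x = 1" "num_form A x \<bullet> exp (\<i> * \<theta>) = lambda_m A \<theta>"
    and "\<And>y. norm y = 1 \<Longrightarrow> num_form A y \<bullet> exp (\<i> * \<theta>) \<le> lambda_m A \<theta>"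
proof -
  let ?B = "A_rot A \<theta>"
  have herm: "hermitian ?B"
    by (simp add: A_rot_def hermitian_mat_Re)
  have form: "Re (num_form ?B y) = num_form A y \<bullet> exp (\<i> * \<theta>)" for y
    by (simp add: num_form_A_rot)
  have "continuous_on (sphere 0 1) (\<lambda>y. Re (num_form ?B y))"
    by (intro continuous_intros continuous_on_num_form)
  then obtain x where x: "norm x = 1"
    and max: "\<And>y. norm y = 1 \<Longrightarrow> Re (num_form ?B y) \<le> Re (num_form ?B x)"
    by (rule unit_sphere_attains_max) blast
  define m where "m = Re (num_form ?B x)"
  have le_m: "Re (num_form ?B y) \<le> m" if "norm y = 1" for y
    unfolding m_def using that by (rule max)
  have "cinner z (?B *v x - of_real m *s x) = 0" for z
    by (rule maximizer_stationary[OF csubspace_UNIV herm le_m]) (simp_all add: x m_def)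
  then have "?B *v x = of_real m *s x"
    using cinner_self[of "?B *v x - of_real m *s x"] by simp
  then have ev: "eigenvalue_on UNIV ((*v) ?B) (of_real m)"
    using x by (auto simp: eigenvalue_on_def eigenspace_on_def intro!: bexI[of _ x])
  have "r \<le> m" if r: "eigenvalue_on UNIV ((*v) ?B) (of_real r)" for r
  proof -
    obtain y where y: "?B *v y = of_real r *s y" "y \<noteq> 0"
      using r by (auto simp: eigenvalue_on_def eigenspace_on_def)
    have "Re (num_form ?B y) \<le> m * (norm y)\<^sup>2"
      by (rule num_form_le_normalized[OF csubspace_UNIV le_m]) simp_all
    moreover have "Re (num_form ?B y) = r * (norm y)\<^sup>2"
      using y by (simp add: num_form_def cinner_scale_right cinner_self flip: of_real_power)
    ultimately show ?thesis
      using y(2) by simp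
  qed
  with ev have "lambda_m A \<theta> = m"
    unfolding lambda_m_def by (rule Greatest_equality)
  then show thesis
    using that[of x] x le_m by (simp add: m_def form)
qed

lemma csubspace_X_m: "csubspace (X_m A \<theta>)"
  unfolding X_m_def by (rule csubspace_eigenspace)

lemma X_m_iff:
  assumes "norm x = 1"
  shows "x \<in> X_m A \<theta> \<longleftrightarrow> num_form A x \<bullet> exp (\<i> * \<theta>) = lambda_m A \<theta>"
proof -
  let ?B = "A_rot A \<theta>"
  have form: "Re (num_form ?B y) = num_form A y \<bullet> exp (\<i> * \<theta>)" for y
    by (simp add: num_form_A_rot)
  have le: "num_form A y \<bullet> exp (\<i> * \<theta>) \<le> lambda_m A \<theta>" if "norm y = 1" for y
    using that by (metis lambda_m_max)
  show ?thesis
  proof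
    assume "x \<in> X_m A \<theta>"
    then have "Re (num_form ?B x) = lambda_m A \<theta>"
      using assms by (simp add: X_m_def eigenspace_on_def num_form_def cinner_scale_right cinner_self)
    then show "num_form A x \<bullet> exp (\<i> * \<theta>) = lambda_m A \<theta>"
      by (simp add: form)
  next
    assume eq: "num_form A x \<bullet> exp (\<i> * \<theta>) = lambda_m A \<theta>"
    have "hermitian ?B"
      by (simp add: A_rot_def hermitian_mat_Re)
    then have "cinner z (?B *v x - of_real (lambda_m A \<theta>) *s x) = 0" for z
      using maximizer_stationary[OF csubspace_UNIV, of ?B "lambda_m A \<theta>" x z] assms eq le
      by (simp add: form)
    then show "x \<in> X_m A \<theta>"
      using cinner_self[of "?B *v x - of_real (lambda_m A \<theta>) *s x"]
      by (simp add: X_m_def eigenspace_on_def)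
  qed
qed

section \<open>The one-sided derivative of the largest eigenvalue\<close>

text \<open>
  A point that maximizes \<open>g\<close> and, among those maximizers, \<open>k\<close>, gives the lower bound
  \<open>cos t h + sin t M\<close> for \<open>H t\<close>. For the upper bound, points with \<open>k \<ge> M + \<epsilon>\<close> form a compact set
  on which \<open>g\<close> stays below \<open>h\<close> by a fixed gap; since \<open>sin t \<rightarrow> 0\<close>, such a point cannot attain \<open>H t\<close>
  for small \<open>t\<close>, so that \<open>H t \<le> cos t h + sin t (M + \<epsilon>)\<close>.
\<close>
lemma rotated_max_right_derivative:
  fixes g k :: "'a::topological_space \<Rightarrow> real"
  assumes K: "compact K" and g: "continuous_on K g" and k: "continuous_on K k"
    and g_le: "\<And>a. a \<in> K \<Longrightarrow> g a \<le> h"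
    and a0: "a0 \<in> K" "g a0 = h" "k a0 = M"
    and k_le: "\<And>a. a \<in> K \<Longrightarrow> g a = h \<Longrightarrow> k a \<le> M"
    and H_le: "\<And>t a. a \<in> K \<Longrightarrow> cos t * g a + sin t * k a \<le> H t"
    and H_att: "\<And>t. \<exists>a\<in>K. H t = cos t * g a + sin t * k a"
  shows "((\<lambda>t. (1 / t) * (H t - h)) \<longlongrightarrow> M) (at_right 0)"
proof -
  have lim: "((\<lambda>t. (1 / t) * (cos t * h + sin t * c - h)) \<longlongrightarrow> c) (at_right 0)" for c
  proof -
    have "((\<lambda>t. cos t * h + sin t * c) has_field_derivative c) (at 0)"
      by (auto intro!: derivative_eq_intros)
    then have "((\<lambda>t. (cos t * h + sin t * c - h) / t) \<longlongrightarrow> c) (at 0)"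
      by (simp add: has_field_derivative_iff)
    then have "((\<lambda>t. (cos t * h + sin t * c - h) / t) \<longlongrightarrow> c) (at_right 0)"
      by (rule filterlim_mono) (simp_all add: at_le)
    then show ?thesis
      by simp
  qed
  have small: "\<forall>\<^sub>F t in at_right 0. 0 < t \<and> t < (1::real)"
    by (auto simp: eventually_at_right_less eventually_at_right[of 0 1] intro!: exI[of _ 1])
  have upper: "\<forall>\<^sub>F t in at_right 0. H t \<le> cos t * h + sin t * (M + \<epsilon>)" if \<epsilon>: "\<epsilon> > 0" for \<epsilon>
  proof -
    let ?L = "{a \<in> K. M + \<epsilon> \<le> k a}"
    have L: "compact ?L"
    proof -
      obtain S where "closed S" "S \<inter> K = K \<inter> k -` {M + \<epsilon>..}"
        using k unfolding continuous_on_closed_invariant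
        by (metis Int_commute closed_atLeast)
      moreover have "?L = K \<inter> k -` {M + \<epsilon>..}"
        by auto
      ultimately show ?thesis
        using compact_Int_closed[OF K, of S] by (simp add: Int_commute)
    qed
    obtain m where m: "m < h" "\<And>a. a \<in> ?L \<Longrightarrow> g a \<le> m"
    proof (cases "?L = {}")
      case True
      then show thesis
        by (intro that[of "h - 1"]) auto
    next
      case False
      have "continuous_on ?L g"
        by (rule continuous_on_subset[OF g]) auto
      then obtain a where a: "a \<in> ?L" "\<And>b. b \<in> ?L \<Longrightarrow> g b \<le> g a"
        using continuous_attains_sup[OF L False] by blast
      have "g a < h"
        using a(1) g_le[of a] k_le[of a] \<epsilon> by fastforce
      then show thesis
        using a(2) by (rule that)
    qed
    obtain C where C: "\<And>a. a \<in> K \<Longrightarrow> k a \<le> C"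
      using continuous_attains_sup[OF K _ k] a0(1) by (metis empty_iff)
    have "((\<lambda>t. cos t * (h - m) + sin t * (M - C)) \<longlongrightarrow> cos 0 * (h - m) + sin 0 * (M - C)) (at_right 0)"
      by (intro tendsto_intros)
    then have "\<forall>\<^sub>F t in at_right 0. 0 < cos t * (h - m) + sin t * (M - C)"
      using m(1) by (intro order_tendstoD) auto
    then show ?thesis
      using small
    proof eventually_elim
      case (elim t)
      have t: "0 \<le> cos t" "0 \<le> sin t"
        using elim pi_gt3 by (auto intro!: cos_ge_zero sin_ge_zero)
      obtain a where a: "a \<in> K" "H t = cos t * g a + sin t * k a"
        using H_att by blast
      have "a \<notin> ?L"
      proof
        assume "a \<in> ?L"
        then have "H t \<le> cos t * m + sin t * C"
          unfolding a(2) using t m(2) C a(1) by (intro add_mono mult_left_mono) auto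
        moreover have "cos t * h + sin t * M \<le> H t"
          using H_le[OF a0(1), of t] a0(2,3) by simp
        ultimately show False
          using elim(1) by (simp add: algebra_simps)
      qed
      then show ?case
        unfolding a(2) using t g_le a(1) by (intro add_mono mult_left_mono) auto
    qed
  qed
  show ?thesis
  proof (rule order_tendstoI)
    fix c assume "c < M"
    with lim[of M] have "\<forall>\<^sub>F t in at_right 0. c < (1 / t) * (cos t * h + sin t * M - h)"
      by (rule order_tendstoD)
    then show "\<forall>\<^sub>F t in at_right 0. c < (1 / t) * (H t - h)"
      using small
    proof eventually_elim
      case (elim t)
      have "(1 / t) * (cos t * h + sin t * M - h) \<le> (1 / t) * (H t - h)"
        using H_le[OF a0(1), of t] a0(2,3) elim(2) by (intro mult_left_mono) auto
      then show ?case
        using elim(1) by linarith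
    qed
  next
    fix c assume "M < c"
    define \<epsilon> where "\<epsilon> = (c - M) / 2"
    have \<epsilon>: "\<epsilon> > 0" "M + \<epsilon> < c"
      using \<open>M < c\<close> by (auto simp: \<epsilon>_def field_simps)
    from lim[of "M + \<epsilon>"] \<epsilon>(2)
    have "\<forall>\<^sub>F t in at_right 0. (1 / t) * (cos t * h + sin t * (M + \<epsilon>) - h) < c"
      by (rule order_tendstoD)
    then show "\<forall>\<^sub>F t in at_right 0. (1 / t) * (H t - h) < c"
      using small upper[OF \<epsilon>(1)]
    proof eventually_elim
      case (elim t)
      have "(1 / t) * (H t - h) \<le> (1 / t) * (cos t * h + sin t * (M + \<epsilon>) - h)"
        using elim(2,3) by (intro mult_left_mono) auto
      then show ?case
        using elim(1) by linarith
    qed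
  qed
qed

lemma inner_rotate:
  assumes "v = 1 \<or> v = -1"
  shows "\<alpha> \<bullet> exp (\<i> * of_real (\<theta> + t * v))
    = cos t * (\<alpha> \<bullet> exp (\<i> * \<theta>)) + sin t * (\<alpha> \<bullet> (of_real v * \<i> * exp (\<i> * \<theta>)))"
  unfolding cis_conv_exp[symmetric]
  using assms by (auto simp: inner_complex_def cos_add sin_add cos_diff sin_diff algebra_simps)

text \<open>
  By \<open>X_m_iff\<close> the unit vectors of \<open>X\<^sub>m(\<theta>)\<close> are the maximizers at \<open>t = 0\<close>, so the derivative of the
  maximum is the largest value of the second form on them; compactness provides a vector that
  attains it.
\<close>
lemma lambda_m'_max:
  assumes v: "v = 1 \<or> v = -1"
  obtains x where "norm x = 1" "x \<in> X_m A \<theta>"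
      "num_form A x \<bullet> (of_real v * \<i> * exp (\<i> * \<theta>)) = lambda_m' A \<theta> v"
    and "\<And>y. norm y = 1 \<Longrightarrow> y \<in> X_m A \<theta> \<Longrightarrow>
      num_form A y \<bullet> (of_real v * \<i> * exp (\<i> * \<theta>)) \<le> lambda_m' A \<theta> v"
proof -
  let ?g = "\<lambda>x. num_form A x \<bullet> exp (\<i> * \<theta>)"
  let ?k = "\<lambda>x. num_form A x \<bullet> (of_real v * \<i> * exp (\<i> * \<theta>))"
  have cont: "continuous_on S ?g" "continuous_on S ?k" for S
    by (intro continuous_intros continuous_on_num_form)+
  have "closed (X_m A \<theta>)"
    by (intro closed_subspace csubspace_imp_subspace csubspace_X_m)
  then have "compact (sphere 0 1 \<inter> X_m A \<theta>)"
    by (intro compact_Int_closed compact_sphere)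
  moreover have "sphere 0 1 \<inter> X_m A \<theta> \<noteq> {}"
    using lambda_m_max[of A \<theta>] X_m_iff[of _ A \<theta>] by (metis IntI empty_iff mem_sphere_0)
  ultimately obtain x where x: "x \<in> sphere 0 1 \<inter> X_m A \<theta>"
      and max: "\<And>y. y \<in> sphere 0 1 \<inter> X_m A \<theta> \<Longrightarrow> ?k y \<le> ?k x"
    using continuous_attains_sup[OF _ _ cont(2)] by metis
  have "((\<lambda>t. (1 / t) * (lambda_m A (\<theta> + t * v) - lambda_m A \<theta>)) \<longlongrightarrow> ?k x) (at_right 0)"
  proof (rule rotated_max_right_derivative[OF compact_sphere[of 0 1] cont])
    show "?g a \<le> lambda_m A \<theta>" if "a \<in> sphere 0 1" for a
      using that by (metis lambda_m_max mem_sphere_0)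
    show "x \<in> sphere 0 1" "?g x = lambda_m A \<theta>" "?k x = ?k x"
      using x X_m_iff[of x A \<theta>] by auto
    show "?k a \<le> ?k x" if "a \<in> sphere 0 1" "?g a = lambda_m A \<theta>" for a
      using that X_m_iff[of a A \<theta>] by (intro max) auto
    show "cos t * ?g a + sin t * ?k a \<le> lambda_m A (\<theta> + t * v)" if "a \<in> sphere 0 1" for t a
      using that inner_rotate[OF v, of "num_form A a" \<theta> t] by (metis lambda_m_max mem_sphere_0)
    show "\<exists>a\<in>sphere 0 1. lambda_m A (\<theta> + t * v) = cos t * ?g a + sin t * ?k a" for t
      using inner_rotate[OF v, of _ \<theta> t] by (metis lambda_m_max mem_sphere_0)
  qed
  then have "lambda_m' A \<theta> v = ?k x"
    unfolding lambda_m'_def by (intro tendsto_Lim) auto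
  then show thesis
    using that[of x] x max by auto
qed

section \<open>Endpoints of exposed faces\<close>

lemma exp_face_iff:
  "\<alpha> \<in> exp_face A \<theta> \<longleftrightarrow> (\<exists>x. \<alpha> = num_form A x \<and> norm x = 1 \<and> x \<in> X_m A \<theta>)"
proof -
  obtain x0 where x0: "norm x0 = 1" "num_form A x0 \<bullet> exp (\<i> * \<theta>) = lambda_m A \<theta>"
    and le: "\<And>y. norm y = 1 \<Longrightarrow> num_form A y \<bullet> exp (\<i> * \<theta>) \<le> lambda_m A \<theta>"
    by (rule lambda_m_max[of A \<theta>]) blast
  have "num_form A x \<in> exp_face A \<theta> \<longleftrightarrow> x \<in> X_m A \<theta>" if "norm x = 1" for x
    using that x0 le[OF that] X_m_iff[OF that, of A \<theta>] le
    by (fastforce simp: exp_face_def is_arg_max_linorder numerical_range_def cinner_self_eq_1_iff)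
  moreover have "\<exists>x. norm x = 1 \<and> \<alpha> = num_form A x" if "\<alpha> \<in> exp_face A \<theta>"
    using that
    by (auto simp: exp_face_def is_arg_max_linorder numerical_range_def cinner_self_eq_1_iff)
  ultimately show ?thesis
    by blast
qed

lemma complex_eq_if_coordinates_eq:
  assumes v: "v = 1 \<or> v = -1"
    and "\<alpha> \<bullet> exp (\<i> * of_real \<theta>) = \<beta> \<bullet> exp (\<i> * of_real \<theta>)"
    and "\<alpha> \<bullet> (of_real v * \<i> * exp (\<i> * of_real \<theta>)) = \<beta> \<bullet> (of_real v * \<i> * exp (\<i> * of_real \<theta>))"
  shows "\<alpha> = \<beta>"
proof -
  \<comment> \<open>Up to the sign \<open>v\<close>, the real and the imaginary part of \<open>w\<close> are the differences of the
    two given coordinates.\<close>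
  let ?w = "(\<alpha> - \<beta>) * cis (- \<theta>)"
  have "Re ?w = 0" "Im ?w = 0"
    using assms unfolding cis_conv_exp[symmetric]
    by (auto simp: inner_complex_def algebra_simps)
  then have "?w = 0"
    by (simp add: complex_eq_iff)
  then show ?thesis
    by simp
qed

text \<open>
  The endpoint is the point whose coordinates along \<open>u = exp(\<i>\<theta>)\<close> and \<open>v\<i>u\<close> are
  \<open>\<lambda>\<^sub>m(\<theta>)\<close> and \<open>\<lambda>\<^sub>m'(\<theta>; v)\<close>. The condition that \<open>f x\<close> has these coordinates is membership of
  \<open>x\<close> in the eigenspace \<open>X\<^sub>m(\<theta>)\<close> and then in the eigenspace of the compression.
\<close>
lemma face_endpoint_iff:
  assumes v: "v = 1 \<or> v = -1" and x: "norm x = 1"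
  shows "num_form A x
      = (THE p. is_arg_max (\<lambda>\<alpha>. \<alpha> \<bullet> (of_real v * \<i> * exp (\<i> * \<theta>))) (\<lambda>\<alpha>. \<alpha> \<in> exp_face A \<theta>) p)
    \<longleftrightarrow> x \<in> eigenspace_on (X_m A \<theta>) (compression (A_rot' A \<theta>) (X_m A \<theta>))
          (of_real (v * lambda_m' A \<theta> v))"
proof -
  let ?k = "\<lambda>\<alpha>. \<alpha> \<bullet> (of_real v * \<i> * exp (\<i> * \<theta>))"
  let ?end = "is_arg_max ?k (\<lambda>\<alpha>. \<alpha> \<in> exp_face A \<theta>)"
  let ?M = "lambda_m' A \<theta> v"
  obtain x0 where x0: "norm x0 = 1" "x0 \<in> X_m A \<theta>" "?k (num_form A x0) = ?M"
    and le: "\<And>y. norm y = 1 \<Longrightarrow> y \<in> X_m A \<theta> \<Longrightarrow> ?k (num_form A y) \<le> ?M"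
    by (rule lambda_m'_max[OF v, of A \<theta>]) blast
  have end_iff: "?end p \<longleftrightarrow> p \<in> exp_face A \<theta> \<and> ?k p = ?M" for p
    using x0 le by (fastforce simp: is_arg_max_linorder exp_face_iff)
  have coord: "p \<bullet> exp (\<i> * \<theta>) = lambda_m A \<theta>" if "p \<in> exp_face A \<theta>" for p
    using that X_m_iff by (auto simp: exp_face_iff)
  have uniq: "p = q" if "?end p" "?end q" for p q
    using that coord by (intro complex_eq_if_coordinates_eq[OF v, of p \<theta> q]) (auto simp: end_iff)
  have end0: "?end (num_form A x0)"
    unfolding end_iff using x0 by (auto simp: exp_face_iff)
  have "?end (THE p. ?end p)"
    by (rule theI[where P = ?end, OF end0]) (rule uniq[OF _ end0])
  then have "num_form A x = (THE p. ?end p) \<longleftrightarrow> ?end (num_form A x)"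
    using uniq by metis
  also have "\<dots> \<longleftrightarrow> x \<in> X_m A \<theta> \<and> ?k (num_form A x) = ?M"
    using x coord X_m_iff[OF x, of A \<theta>] unfolding end_iff by (auto simp: exp_face_iff)
  also have "\<dots> \<longleftrightarrow> x \<in> X_m A \<theta> \<and> Re (num_form (A_rot' A \<theta>) x) = v * ?M"
    using v by (auto simp: num_form_A_rot')
  also have "\<dots> \<longleftrightarrow> x \<in> eigenspace_on (X_m A \<theta>) (compression (A_rot' A \<theta>) (X_m A \<theta>))
      (of_real (v * ?M))"
  proof (rule compression_eigenspace_iff[symmetric, OF csubspace_X_m _ _ v x])
    show "hermitian (A_rot' A \<theta>)"
      by (simp add: A_rot'_def hermitian_mat_Im)
    show "\<forall>y\<in>X_m A \<theta>. norm y = 1 \<longrightarrow>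
        v * Re (num_form (A_rot' A \<theta>) y) \<le> v * (v * ?M)"
      using v le by (auto simp: num_form_A_rot')
  qed
  finally show ?thesis .
qed

theorem corollary2p4:
  fixes A :: "complex^'n^'n" and \<theta> :: real and x :: "complex^'n"
  assumes "norm x = 1"
  shows "(num_form A x = p_plus A \<theta> \<longleftrightarrow> x \<in> X_plus A \<theta>) \<and>
         (num_form A x = p_minus A \<theta> \<longleftrightarrow> x \<in> X_minus A \<theta>)"
  using face_endpoint_iff[of 1, OF _ assms, of A \<theta>] face_endpoint_iff[of "-1", OF _ assms, of A \<theta>]
  by (simp add: p_plus_def X_plus_def p_minus_def X_minus_def)

end
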